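(* Let $A\subseteq(0,1)$ have no limit points in $[0,1]$ (i.e. $A'=\emptyset$; equivalently $A$ is finite). In the Gödel logic $\mathfrak{G}_{[0,1],A}$, every strongly consistent $\mathcal{L}$-theory $T$ is contained in a strongly consistent, deductively complete, deductively Henkin $\mathcal{L}'$-theory for some first-order language $\mathcal{L}'\supseteq\mathcal{L}$.
   Context: The logic $\mathfrak{G}_{[0,1],A}$ over a first-order language $\mathcal{L}$ has connectives $\wedge,\to,\bot$, quantifiers $\forall,\exists$, and nullary connectives $\bar r$ for $r\in A$ ($\bar1$ is $\bot$, $\bar0$ available). Abbreviations: $\neg\varphi:=\varphi\to\bot$, $\varphi\vee\psi:=((\varphi\to\psi)\to\psi)\wedge((\psi\to\varphi)\to\varphi)$, $\varphi\leftrightarrow\psi:=(\varphi\to\psi)\wedge(\psi\to\varphi)$. Proof system: axioms (G1) $(\varphi\to\psi)\to((\psi\to\chi)\to(\varphi\to\chi))$; (G2) $(\varphi\wedge\psi)\to\varphi$; (G3) $(\varphi\wedge\psi)\to(\psi\wedge\varphi)$; (G4) $\varphi\to(\varphi\wedge\varphi)$; (G5) $(\varphi\to(\psi\to\chi))\leftrightarrow((\varphi\wedge\psi)\to\chi)$; (G6) $((\varphi\to\psi)\to\chi)\to(((\psi\to\varphi)\to\chi)\to\chi)$; (G7) $\bar1\to\varphi$; (G$\forall$1) $\forall x\varphi(x)\to\varphi(t)$; (G$\forall$2) $\forall x(\psi\to\varphi(x))\to(\psi\to\forall x\varphi(x))$, $x$ not free in $\psi$; (G$\forall$3) $\forall x(\psi\vee\varphi(x))\to(\psi\vee\forall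 x\varphi(x))$, $x$ not free in $\psi$; (G$\exists$1) $\varphi(t)\to\exists x\varphi(x)$; (G$\exists$2) $\forall x(\varphi(x)\to\psi)\to(\exists x\varphi(x)\to\psi)$, $x$ not free in $\psi$ ($t$ substitutable); for $r,s\in A\cup\{0,1\}$: (RG1) $(\bar r\wedge\bar s)\leftrightarrow\overline{\max\{r,s\}}$; (RG2a) $\bar r\to\bar s$ for $r\ge s$; (RG2b) $(\bar r\to\bar s)\leftrightarrow\bar s$ for $r<s$; (RG3) $\neg\neg\bar r$ for $r<1$; rules modus ponens and generalization. $T\vdash\varphi$ means a finite derivation from $T$ and the axioms; theories are sets of sentences. $T$ is strongly consistent if $T\nvdash\bar r$ for every $r\in A\cup\{1\}$. An $\mathcal{L}'$-theory $T$ is deductively complete if for every pair of $\mathcal L'$-sentences $\varphi,\psi$, $T\vdash\varphi\to\psi$ or $T\vdash\psi\to\varphi$; it is deductively Henkin if for every $\mathcal L'$-sentence $\forall x\,\varphi(x)$ with $T\nvdash\forall x\,\varphi(x)$ there is a constant symbol $c$ of $\mathcal L'$ with $T\nvdash\varphi(c)$. *)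

theory Defs
  imports "HOL-Analysis.Elementary_Topology"
begin

text \<open>
  A first-order language is a set of function symbols and a set of relation symbols with
  arities; the values of the arity functions outside these sets are irrelevant. Constant
  symbols are the function symbols of arity 0.
\<close>

record ('f, 'p) lang =
  funs :: "'f set"
  farity :: "'f \<Rightarrow> nat"
  rels :: "'p set"
  rarity :: "'p \<Rightarrow> nat"

definition constants :: "('f, 'p) lang \<Rightarrow> 'f set" where
  "constants L = {c \<in> funs L. farity L c = 0}"

datatype 'f tm = Var nat | Fn 'f "'f tm list"

datatype ('f, 'p) fm =
    Bot
  | Cst real
  | Rel 'p "'f tm list"
  | And "('f, 'p) fm" "('f, 'p) fm"
  | Imp "('f, 'p) fm" "('f, 'p) fm"
  | All nat "('f, 'p) fm"
  | Ex nat "('f, 'p) fm"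

abbreviation Neg :: "('f, 'p) fm \<Rightarrow> ('f, 'p) fm" where
  "Neg \<phi> \<equiv> Imp \<phi> Bot"

abbreviation Or :: "('f, 'p) fm \<Rightarrow> ('f, 'p) fm \<Rightarrow> ('f, 'p) fm" where
  "Or \<phi> \<psi> \<equiv> And (Imp (Imp \<phi> \<psi>) \<psi>) (Imp (Imp \<psi> \<phi>) \<phi>)"

abbreviation Iff :: "('f, 'p) fm \<Rightarrow> ('f, 'p) fm \<Rightarrow> ('f, 'p) fm" where
  "Iff \<phi> \<psi> \<equiv> And (Imp \<phi> \<psi>) (Imp \<psi> \<phi>)"

text \<open>
  The truth constants. The value 0 is absolute truth and 1 is absolute falsity. The only
  nullary connectives are \<open>\<bottom>\<close> and those for \<open>r \<in> A\<close>, so the constant for 1 is \<open>\<bottom>\<close> and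
  the constant for 0 is \<open>\<not>\<bottom>\<close>.
\<close>

definition rbar :: "real \<Rightarrow> ('f, 'p) fm" where
  "rbar r = (if r = 1 then Bot else if r = 0 then Neg Bot else Cst r)"

fun wf_tm :: "('f, 'p) lang \<Rightarrow> 'f tm \<Rightarrow> bool" where
  "wf_tm L (Var x) = True"
| "wf_tm L (Fn f ts) = (f \<in> funs L \<and> length ts = farity L f \<and> (\<forall>t \<in> set ts. wf_tm L t))"

fun wf_fm :: "('f, 'p) lang \<Rightarrow> real set \<Rightarrow> ('f, 'p) fm \<Rightarrow> bool" where
  "wf_fm L A Bot = True"
| "wf_fm L A (Cst r) = (r \<in> A)"
| "wf_fm L A (Rel p ts) = (p \<in> rels L \<and> length ts = rarity L p \<and> (\<forall>t \<in> set ts. wf_tm L t))"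
| "wf_fm L A (And \<phi> \<psi>) = (wf_fm L A \<phi> \<and> wf_fm L A \<psi>)"
| "wf_fm L A (Imp \<phi> \<psi>) = (wf_fm L A \<phi> \<and> wf_fm L A \<psi>)"
| "wf_fm L A (All x \<phi>) = wf_fm L A \<phi>"
| "wf_fm L A (Ex x \<phi>) = wf_fm L A \<phi>"

fun vars_tm :: "'f tm \<Rightarrow> nat set" where
  "vars_tm (Var x) = {x}"
| "vars_tm (Fn f ts) = (\<Union>t \<in> set ts. vars_tm t)"

fun free_vars :: "('f, 'p) fm \<Rightarrow> nat set" where
  "free_vars Bot = {}"
| "free_vars (Cst r) = {}"
| "free_vars (Rel p ts) = (\<Union>t \<in> set ts. vars_tm t)"
| "free_vars (And \<phi> \<psi>) = free_vars \<phi> \<union> free_vars \<psi>"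
| "free_vars (Imp \<phi> \<psi>) = free_vars \<phi> \<union> free_vars \<psi>"
| "free_vars (All x \<phi>) = free_vars \<phi> - {x}"
| "free_vars (Ex x \<phi>) = free_vars \<phi> - {x}"

definition sentence :: "('f, 'p) lang \<Rightarrow> real set \<Rightarrow> ('f, 'p) fm \<Rightarrow> bool" where
  "sentence L A \<phi> \<longleftrightarrow> wf_fm L A \<phi> \<and> free_vars \<phi> = {}"

definition is_theory :: "('f, 'p) lang \<Rightarrow> real set \<Rightarrow> ('f, 'p) fm set \<Rightarrow> bool" where
  "is_theory L A T \<longleftrightarrow> (\<forall>\<phi> \<in> T. sentence L A \<phi>)"

fun subst_tm :: "nat \<Rightarrow> 'f tm \<Rightarrow> 'f tm \<Rightarrow> 'f tm" where
  "subst_tm x t (Var y) = (if y = x then t else Var y)"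
| "subst_tm x t (Fn f ts) = Fn f (map (subst_tm x t) ts)"

text \<open>
  \<open>subst x t \<phi>\<close> replaces the free occurrences of \<open>x\<close> by \<open>t\<close> without renaming bound
  variables, so it is only used when \<open>substitutable x t \<phi>\<close> holds (in particular for closed \<open>t\<close>).
\<close>

fun subst :: "nat \<Rightarrow> 'f tm \<Rightarrow> ('f, 'p) fm \<Rightarrow> ('f, 'p) fm" where
  "subst x t Bot = Bot"
| "subst x t (Cst r) = Cst r"
| "subst x t (Rel p ts) = Rel p (map (subst_tm x t) ts)"
| "subst x t (And \<phi> \<psi>) = And (subst x t \<phi>) (subst x t \<psi>)"
| "subst x t (Imp \<phi> \<psi>) = Imp (subst x t \<phi>) (subst x t \<psi>)"
| "subst x t (All y \<phi>) = All y (if y = x then \<phi> else subst x t \<phi>)"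
| "subst x t (Ex y \<phi>) = Ex y (if y = x then \<phi> else subst x t \<phi>)"

fun substitutable :: "nat \<Rightarrow> 'f tm \<Rightarrow> ('f, 'p) fm \<Rightarrow> bool" where
  "substitutable x t Bot = True"
| "substitutable x t (Cst r) = True"
| "substitutable x t (Rel p ts) = True"
| "substitutable x t (And \<phi> \<psi>) = (substitutable x t \<phi> \<and> substitutable x t \<psi>)"
| "substitutable x t (Imp \<phi> \<psi>) = (substitutable x t \<phi> \<and> substitutable x t \<psi>)"
| "substitutable x t (All y \<phi>) =
     (x \<notin> free_vars (All y \<phi>) \<or> (y \<notin> vars_tm t \<and> substitutable x t \<phi>))"
| "substitutable x t (Ex y \<phi>) =
     (x \<notin> free_vars (Ex y \<phi>) \<or> (y \<notin> vars_tm t \<and> substitutable x t \<phi>))"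

text \<open>
  Axiom schemata; the restriction to formulas of the language at hand is imposed in
  \<open>provable\<close> below.
\<close>

inductive axiom :: "real set \<Rightarrow> ('f, 'p) fm \<Rightarrow> bool" for A :: "real set" where
  G1: "axiom A (Imp (Imp \<phi> \<psi>) (Imp (Imp \<psi> \<chi>) (Imp \<phi> \<chi>)))"
| G2: "axiom A (Imp (And \<phi> \<psi>) \<phi>)"
| G3: "axiom A (Imp (And \<phi> \<psi>) (And \<psi> \<phi>))"
| G4: "axiom A (Imp \<phi> (And \<phi> \<phi>))"
| G5: "axiom A (Iff (Imp \<phi> (Imp \<psi> \<chi>)) (Imp (And \<phi> \<psi>) \<chi>))"
| G6: "axiom A (Imp (Imp (Imp \<phi> \<psi>) \<chi>) (Imp (Imp (Imp \<psi> \<phi>) \<chi>) \<chi>))"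
| G7: "axiom A (Imp (rbar 1) \<phi>)"
| GAll1: "substitutable x t \<phi> \<Longrightarrow> axiom A (Imp (All x \<phi>) (subst x t \<phi>))"
| GAll2: "x \<notin> free_vars \<psi> \<Longrightarrow> axiom A (Imp (All x (Imp \<psi> \<phi>)) (Imp \<psi> (All x \<phi>)))"
| GAll3: "x \<notin> free_vars \<psi> \<Longrightarrow> axiom A (Imp (All x (Or \<psi> \<phi>)) (Or \<psi> (All x \<phi>)))"
| GEx1: "substitutable x t \<phi> \<Longrightarrow> axiom A (Imp (subst x t \<phi>) (Ex x \<phi>))"
| GEx2: "x \<notin> free_vars \<psi> \<Longrightarrow> axiom A (Imp (All x (Imp \<phi> \<psi>)) (Imp (Ex x \<phi>) \<psi>))"
| RG1: "r \<in> A \<union> {0, 1} \<Longrightarrow> s \<in> A \<union> {0, 1} \<Longrightarrow>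
    axiom A (Iff (And (rbar r) (rbar s)) (rbar (max r s)))"
| RG2a: "r \<in> A \<union> {0, 1} \<Longrightarrow> s \<in> A \<union> {0, 1} \<Longrightarrow> r \<ge> s \<Longrightarrow>
    axiom A (Imp (rbar r) (rbar s))"
| RG2b: "r \<in> A \<union> {0, 1} \<Longrightarrow> s \<in> A \<union> {0, 1} \<Longrightarrow> r < s \<Longrightarrow>
    axiom A (Iff (Imp (rbar r) (rbar s)) (rbar s))"
| RG3: "r \<in> A \<union> {0, 1} \<Longrightarrow> r < 1 \<Longrightarrow> axiom A (Neg (Neg (rbar r)))"

inductive provable ::
  "('f, 'p) lang \<Rightarrow> real set \<Rightarrow> ('f, 'p) fm set \<Rightarrow> ('f, 'p) fm \<Rightarrow> bool"
  for L :: "('f, 'p) lang" and A :: "real set" and T :: "('f, 'p) fm set" where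
  Hyp: "\<phi> \<in> T \<Longrightarrow> provable L A T \<phi>"
| Ax: "axiom A \<phi> \<Longrightarrow> wf_fm L A \<phi> \<Longrightarrow> provable L A T \<phi>"
| MP: "provable L A T \<phi> \<Longrightarrow> provable L A T (Imp \<phi> \<psi>) \<Longrightarrow> provable L A T \<psi>"
| Gen: "provable L A T \<phi> \<Longrightarrow> provable L A T (All x \<phi>)"

definition strongly_consistent ::
    "('f, 'p) lang \<Rightarrow> real set \<Rightarrow> ('f, 'p) fm set \<Rightarrow> bool" where
  "strongly_consistent L A T \<longleftrightarrow> (\<forall>r \<in> A \<union> {1}. \<not> provable L A T (rbar r))"

definition deductively_complete ::
    "('f, 'p) lang \<Rightarrow> real set \<Rightarrow> ('f, 'p) fm set \<Rightarrow> bool" where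
  "deductively_complete L A T \<longleftrightarrow>
     (\<forall>\<phi> \<psi>. sentence L A \<phi> \<longrightarrow> sentence L A \<psi> \<longrightarrow>
        provable L A T (Imp \<phi> \<psi>) \<or> provable L A T (Imp \<psi> \<phi>))"

definition deductively_Henkin ::
    "('f, 'p) lang \<Rightarrow> real set \<Rightarrow> ('f, 'p) fm set \<Rightarrow> bool" where
  "deductively_Henkin L A T \<longleftrightarrow>
     (\<forall>x \<phi>. sentence L A (All x \<phi>) \<longrightarrow> \<not> provable L A T (All x \<phi>) \<longrightarrow>
        (\<exists>c \<in> constants L. \<not> provable L A T (subst x (Fn c []) \<phi>)))"

text \<open>
  The function symbols of \<open>L\<close> may already exhaust their type, so an extension of \<open>L\<close> has its
  function symbols in \<open>'f + 'c\<close>, with those of \<open>L\<close> included via \<open>Inl\<close>; correspondingly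
  \<open>lift_fm\<close> is the inclusion of the \<open>L\<close>-formulas into the formulas of the extension.
\<close>

definition lang_extends :: "('f + 'c, 'p) lang \<Rightarrow> ('f, 'p) lang \<Rightarrow> bool" where
  "lang_extends L' L \<longleftrightarrow>
     Inl ` funs L \<subseteq> funs L' \<and> (\<forall>f \<in> funs L. farity L' (Inl f) = farity L f) \<and>
     rels L \<subseteq> rels L' \<and> (\<forall>p \<in> rels L. rarity L' p = rarity L p)"

abbreviation lift_fm :: "('f, 'p) fm \<Rightarrow> ('f + 'c, 'p) fm" where
  "lift_fm \<equiv> map_fm Inl id"

text \<open>
  HOL cannot quantify existentially over types. Taking \<open>'c = ('f, 'p) fm\<close> leaves at least as
  many potential new symbols as there are formulas in any language over \<open>('f + 'c, 'p)\<close>.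
\<close>

type_synonym ('f, 'p) ext_sym = "'f + ('f, 'p) fm"

end

theory Submission
  imports Defs
begin

text \<open>
  Since \<open>A\<close> is bounded without limit points it is finite, so strong consistency only says that
  the single sentence \<open>\<rho> = rbar (Min (A \<union> {1}))\<close> is not provable: every other truth constant
  implies it.

  An infimum in \<open>[0,1]\<close> need not be attained, so the classical Henkin axioms
  \<open>\<phi>(c) \<rightarrow> \<forall>x \<phi>(x)\<close> are not conservative. Instead every universal sentence \<open>\<xi> = \<forall>x \<phi>(x)\<close> receives
  a witness constant \<open>c\<close> and must be decided: either \<open>\<xi>\<close> becomes an axiom, or \<open>\<phi>(c)\<close> joins \<open>\<rho>\<close> in
  a disjunction that must not become provable. If every decision on a finite set of universal
  sentences fails for the given theory, then \<open>\<rho>\<close> was already provable: the witness of largest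
  rank is fresh, so it can be generalized, and (G\<open>\<forall>\<close>3) moves the quantifier inside the disjunction.
  A theory that is maximal among those for which no finite set of decisions fails is prime, hence
  complete by prelinearity, and it contains \<open>\<xi>\<close> as soon as it proves \<open>\<phi>(c)\<close>. Maximality thus
  replaces a transfinite enumeration of the sentences, and primality replaces the choice of
  decisions.
\<close>

section \<open>Syntax\<close>

fun vars_fm :: "('f, 'p) fm \<Rightarrow> nat set" where
  "vars_fm Bot = {}"
| "vars_fm (Cst r) = {}"
| "vars_fm (Rel p ts) = (\<Union>t \<in> set ts. vars_tm t)"
| "vars_fm (And \<phi> \<psi>) = vars_fm \<phi> \<union> vars_fm \<psi>"
| "vars_fm (Imp \<phi> \<psi>) = vars_fm \<phi> \<union> vars_fm \<psi>"
| "vars_fm (All x \<phi>) = insert x (vars_fm \<phi>)"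
| "vars_fm (Ex x \<phi>) = insert x (vars_fm \<phi>)"

lemma finite_vars_tm: "finite (vars_tm t)"
  by (induction t) auto

lemma finite_vars_fm: "finite (vars_fm \<phi>)"
  by (induction \<phi>) (auto simp: finite_vars_tm)

lemma free_vars_subset_vars_fm: "free_vars \<phi> \<subseteq> vars_fm \<phi>"
  by (induction \<phi>) auto

lemma subst_tm_id: "x \<notin> vars_tm s \<Longrightarrow> subst_tm x t s = s"
  by (induction s) (auto intro: map_idI)

lemma subst_id: "x \<notin> free_vars \<phi> \<Longrightarrow> subst x t \<phi> = \<phi>"
  by (induction \<phi>) (auto intro!: map_idI subst_tm_id)

lemma substitutable_if_not_free: "x \<notin> free_vars \<phi> \<Longrightarrow> substitutable x t \<phi>"
  by (induction \<phi>) auto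

lemma vars_subst_tm_closed: "vars_tm t = {} \<Longrightarrow> vars_tm (subst_tm x t s) = vars_tm s - {x}"
  by (induction s) auto

lemma free_vars_subst_closed: "vars_tm t = {} \<Longrightarrow> free_vars (subst x t \<phi>) = free_vars \<phi> - {x}"
  by (induction \<phi>) (auto simp: vars_subst_tm_closed)

lemma wf_subst_tm: "wf_tm L t \<Longrightarrow> wf_tm L s \<Longrightarrow> wf_tm L (subst_tm x t s)"
  by (induction s) auto

lemma wf_subst: "wf_tm L t \<Longrightarrow> wf_fm L A \<phi> \<Longrightarrow> wf_fm L A (subst x t \<phi>)"
  by (induction \<phi>) (auto simp: wf_subst_tm)

lemma funs_subst_tm: "set_tm (subst_tm x t s) \<subseteq> set_tm s \<union> set_tm t"
  by (induction s) auto

lemma funs_subst: "set1_fm (subst x t \<phi>) \<subseteq> set1_fm \<phi> \<union> set_tm t"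
  by (induction \<phi>) (auto dest!: subsetD[OF funs_subst_tm])

lemma subst_tm_back: "y \<notin> vars_tm s \<Longrightarrow> subst_tm y (Var x) (subst_tm x (Var y) s) = s"
  by (induction s) (auto intro: map_idI)

text \<open>\<open>y\<close> has no occurrence in \<open>\<phi>\<close>, free or bound, so after the
  first substitution it stands exactly where \<open>x\<close> was free.\<close>

lemma subst_back: "y \<notin> vars_fm \<phi> \<Longrightarrow> subst y (Var x) (subst x (Var y) \<phi>) = \<phi>"
proof (induction \<phi>)
  case (Rel p ts)
  then show ?case by (auto intro!: map_idI subst_tm_back)
next
  case (All z \<phi>)
  then show ?case using free_vars_subset_vars_fm[of \<phi>] by (auto intro!: subst_id)
next
  case (Ex z \<phi>)
  then show ?case using free_vars_subset_vars_fm[of \<phi>] by (auto intro!: subst_id)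
qed auto

lemma substitutable_back: "y \<notin> vars_fm \<phi> \<Longrightarrow> substitutable y (Var x) (subst x (Var y) \<phi>)"
  by (induction \<phi>) (use free_vars_subset_vars_fm in \<open>auto intro: substitutable_if_not_free\<close>)

lemma wf_rbar: "r \<in> A \<union> {0, 1} \<Longrightarrow> wf_fm L A (rbar r)"
  by (auto simp: rbar_def)

lemma sentence_rbar: "r \<in> A \<union> {0, 1} \<Longrightarrow> sentence L A (rbar r)"
  by (auto simp: rbar_def sentence_def)

section \<open>Replacing function symbols by a variable\<close>

text \<open>A symbol on which \<open>h\<close> is undefined takes its arguments with it: the whole
  term becomes \<open>y\<close>. One translation thus serves both to eliminate a single fresh
  constant and to eliminate all new constants of an extension.\<close>

primrec tr_tm :: "('g \<Rightarrow> 'f option) \<Rightarrow> nat \<Rightarrow> 'g tm \<Rightarrow> 'f tm" where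
  "tr_tm h y (Var x) = Var x"
| "tr_tm h y (Fn g ts) =
    (case h g of None \<Rightarrow> Var y | Some f \<Rightarrow> Fn f (map (tr_tm h y) ts))"

primrec tr :: "('g \<Rightarrow> 'f option) \<Rightarrow> nat \<Rightarrow> ('g, 'p) fm \<Rightarrow> ('f, 'p) fm" where
  "tr h y Bot = Bot"
| "tr h y (Cst r) = Cst r"
| "tr h y (Rel p ts) = Rel p (map (tr_tm h y) ts)"
| "tr h y (And \<phi> \<psi>) = And (tr h y \<phi>) (tr h y \<psi>)"
| "tr h y (Imp \<phi> \<psi>) = Imp (tr h y \<phi>) (tr h y \<psi>)"
| "tr h y (All x \<phi>) = All x (tr h y \<phi>)"
| "tr h y (Ex x \<phi>) = Ex x (tr h y \<phi>)"

lemma vars_tr_tm: "vars_tm (tr_tm h y t) \<subseteq> insert y (vars_tm t)"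
proof (induction t)
  case (Fn g ts)
  then show ?case by (cases "h g") auto
qed simp

lemma free_vars_tr: "free_vars (tr h y \<phi>) \<subseteq> insert y (free_vars \<phi>)"
  by (induction \<phi>) (auto dest!: subsetD[OF vars_tr_tm])

lemma tr_subst_tm: "x \<noteq> y \<Longrightarrow> tr_tm h y (subst_tm x t s) = subst_tm x (tr_tm h y t) (tr_tm h y s)"
  by (induction s) (auto split: option.split)

lemma tr_subst: "x \<noteq> y \<Longrightarrow> tr h y (subst x t \<phi>) = subst x (tr_tm h y t) (tr h y \<phi>)"
  by (induction \<phi>) (auto simp: tr_subst_tm)

lemma substitutable_tr:
  "substitutable x t \<phi> \<Longrightarrow> x \<noteq> y \<Longrightarrow> y \<notin> vars_fm \<phi> \<Longrightarrow>
    substitutable x (tr_tm h y t) (tr h y \<phi>)"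
proof (induction \<phi>)
  case (All z \<phi>)
  then show ?case using free_vars_tr[of h y \<phi>] vars_tr_tm[of h y t] by auto
next
  case (Ex z \<phi>)
  then show ?case using free_vars_tr[of h y \<phi>] vars_tr_tm[of h y t] by auto
qed auto

lemma tr_rbar: "tr h y (rbar r) = rbar r"
  by (auto simp: rbar_def)

text \<open>The only variable introduced is \<open>y\<close>, which avoids all variables of the
  axiom; hence side conditions survive and no quantifier captures it.\<close>

lemma axiom_tr: "axiom A \<phi> \<Longrightarrow> y \<notin> vars_fm \<phi> \<Longrightarrow> axiom A (tr h y \<phi>)"
proof (induction rule: axiom.induct)
  case (GAll1 x t \<phi>)
  then show ?case by (auto simp: tr_subst intro!: axiom.GAll1 substitutable_tr)
next
  case (GAll2 x \<psi> \<phi>)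
  then show ?case using free_vars_tr[of h y \<psi>] by (auto intro!: axiom.GAll2)
next
  case (GAll3 x \<psi> \<phi>)
  then show ?case using free_vars_tr[of h y \<psi>] by (auto intro!: axiom.GAll3)
next
  case (GEx1 x t \<phi>)
  then show ?case by (auto simp: tr_subst intro!: axiom.GEx1 substitutable_tr)
next
  case (GEx2 x \<psi> \<phi>)
  then show ?case using free_vars_tr[of h y \<psi>] by (auto intro!: axiom.GEx2)
qed (simp_all add: tr_rbar axiom.intros)

definition sym_map :: "('g, 'p) lang \<Rightarrow> ('f, 'p) lang \<Rightarrow> ('g \<Rightarrow> 'f option) \<Rightarrow> bool" where
  "sym_map L' L h \<longleftrightarrow>
    (\<forall>g f. g \<in> funs L' \<longrightarrow> h g = Some f \<longrightarrow> f \<in> funs L \<and> farity L f = farity L' g) \<and>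
    (\<forall>p \<in> rels L'. p \<in> rels L \<and> rarity L p = rarity L' p)"

lemma wf_tr_tm: "sym_map L' L h \<Longrightarrow> wf_tm L' t \<Longrightarrow> wf_tm L (tr_tm h y t)"
  by (induction t) (auto simp: sym_map_def split: option.split)

lemma wf_tr: "sym_map L' L h \<Longrightarrow> wf_fm L' A \<phi> \<Longrightarrow> wf_fm L A (tr h y \<phi>)"
  by (induction \<phi>) (auto simp: wf_tr_tm, auto simp: sym_map_def)

text \<open>Each axiom instance in a derivation excludes only its own finitely many variables as
  \<open>y\<close>; modus ponens unites these sets and generalization adds nothing to them.\<close>

lemma provable_tr:
  assumes "provable L' A T' \<phi>" and h: "sym_map L' L h"
    and T: "\<And>\<psi> y. \<psi> \<in> T' \<Longrightarrow> tr h y \<psi> \<in> T"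
  shows "\<exists>F. finite F \<and> (\<forall>y. y \<notin> F \<longrightarrow> provable L A T (tr h y \<phi>))"
  using assms(1)
proof (induction rule: provable.induct)
  case (Hyp \<phi>)
  then show ?case using T by (blast intro: provable.Hyp)
next
  case (Ax \<phi>)
  then show ?case
    using h by (auto intro!: exI[of _ "vars_fm \<phi>"] provable.Ax axiom_tr wf_tr finite_vars_fm)
next
  case (MP \<phi> \<psi>)
  then obtain F G where F: "finite F" "\<forall>y. y \<notin> F \<longrightarrow> provable L A T (tr h y \<phi>)"
    and G: "finite G" "\<forall>y. y \<notin> G \<longrightarrow> provable L A T (tr h y (Imp \<phi> \<psi>))" by blast
  have "provable L A T (tr h y \<psi>)" if "y \<notin> F \<union> G" for y
    by (rule provable.MP[of _ _ _ "tr h y \<phi>"]) (use F G that in auto)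
  then show ?case using F G by (intro exI[of _ "F \<union> G"]) simp
next
  case (Gen \<phi> x)
  then obtain F where "finite F" "\<forall>y. y \<notin> F \<longrightarrow> provable L A T (tr h y \<phi>)" by blast
  then show ?case by (intro exI[of _ F]) (simp add: provable.Gen)
qed

lemma tr_tm_id: "(\<And>g. g \<in> set_tm t \<Longrightarrow> h g = Some g) \<Longrightarrow> tr_tm h y t = t"
  by (induction t) (auto intro: map_idI)

lemma tr_id: "(\<And>g. g \<in> set1_fm \<phi> \<Longrightarrow> h g = Some g) \<Longrightarrow> tr h y \<phi> = \<phi>"
  by (induction \<phi>) (auto intro!: map_idI tr_tm_id)

section \<open>Derivations\<close>

lemma provable_mono: "provable L A T \<phi> \<Longrightarrow> T \<subseteq> U \<Longrightarrow> provable L A U \<phi>"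
proof (induction rule: provable.induct)
  case (MP \<phi> \<psi>)
  then show ?case by (blast intro: provable.MP)
qed (auto intro: provable.Hyp provable.Ax provable.Gen)

lemma provable_finite_subset:
  "provable L A T \<phi> \<Longrightarrow> \<exists>X. finite X \<and> X \<subseteq> T \<and> provable L A X \<phi>"
proof (induction rule: provable.induct)
  case (Hyp \<phi>)
  then show ?case by (intro exI[of _ "{\<phi>}"]) (auto intro: provable.Hyp)
next
  case (Ax \<phi>)
  then show ?case by (intro exI[of _ "{}"]) (auto intro: provable.Ax)
next
  case (MP \<phi> \<psi>)
  then obtain X Y where X: "finite X" "X \<subseteq> T" "provable L A X \<phi>"
    and Y: "finite Y" "Y \<subseteq> T" "provable L A Y (Imp \<phi> \<psi>)" by blast
  have "provable L A (X \<union> Y) \<psi>"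
    by (rule provable.MP[OF provable_mono[OF X(3)] provable_mono[OF Y(3)]]) auto
  then show ?case using X Y by (intro exI[of _ "X \<union> Y"]) auto
next
  case (Gen \<phi> x)
  then obtain X where "finite X" "X \<subseteq> T" "provable L A X \<phi>" by blast
  then show ?case by (intro exI[of _ X]) (simp add: provable.Gen)
qed

abbreviation disj :: "('f, 'p) fm list \<Rightarrow> ('f, 'p) fm \<Rightarrow> ('f, 'p) fm" where
  "disj \<equiv> foldr Or"

lemma wf_disj:
  "wf_fm L A \<rho> \<Longrightarrow> (\<And>d. d \<in> set ds \<Longrightarrow> wf_fm L A d) \<Longrightarrow> wf_fm L A (disj ds \<rho>)"
  by (induction ds) auto

section \<open>Propositional calculus, deduction theorem and finite disjunctions\<close>

context
  fixes L :: "('f, 'p) lang" and A :: "real set" and T :: "('f, 'p) fm set"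
  assumes thy: "is_theory L A T"
begin

abbreviation prv :: "('f, 'p) fm \<Rightarrow> bool" where "prv \<equiv> provable L A T"
abbreviation wf :: "('f, 'p) fm \<Rightarrow> bool" where "wf \<equiv> wf_fm L A"

lemma provable_wf: "prv \<phi> \<Longrightarrow> wf \<phi>"
  by (induction rule: provable.induct) (use thy in \<open>auto simp: is_theory_def sentence_def\<close>)

lemma imp_wf: "prv (Imp a b) \<Longrightarrow> wf a \<and> wf b"
  using provable_wf by fastforce

lemma imp_trans:
  assumes "prv (Imp a b)" "prv (Imp b c)"
  shows "prv (Imp a c)"
proof -
  have "prv (Imp (Imp a b) (Imp (Imp b c) (Imp a c)))"
    using imp_wf[OF assms(1)] imp_wf[OF assms(2)] by (intro Ax axiom.G1) simp
  then show ?thesis by (rule MP[OF assms(2) MP[OF assms(1)]])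
qed

lemma and_elim1: "wf a \<Longrightarrow> wf b \<Longrightarrow> prv (Imp (And a b) a)"
  by (auto intro: Ax axiom.G2)

lemma and_comm: "wf a \<Longrightarrow> wf b \<Longrightarrow> prv (Imp (And a b) (And b a))"
  by (auto intro: Ax axiom.G3)

lemma and_elim2: "wf a \<Longrightarrow> wf b \<Longrightarrow> prv (Imp (And a b) b)"
  using and_comm and_elim1 imp_trans by blast

lemma and_dup: "wf a \<Longrightarrow> prv (Imp a (And a a))"
  by (auto intro: Ax axiom.G4)

lemma imp_refl: "wf a \<Longrightarrow> prv (Imp a a)"
  using and_dup and_elim1 imp_trans by blast

lemma iff_elim:
  assumes "prv (Iff a b)"
  shows "prv (Imp a b)" "prv (Imp b a)"
proof -
  have "wf (Imp a b)" "wf (Imp b a)" using provable_wf[OF assms] by auto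
  then show "prv (Imp a b)" "prv (Imp b a)"
    using MP[OF assms and_elim1] MP[OF assms and_elim2] by simp_all
qed

lemma uncurry:
  assumes "prv (Imp a (Imp b c))"
  shows "prv (Imp (And a b) c)"
proof -
  have "prv (Iff (Imp a (Imp b c)) (Imp (And a b) c))"
    using provable_wf[OF assms] by (intro Ax axiom.G5) simp
  then show ?thesis by (rule MP[OF assms iff_elim(1)])
qed

lemma curry:
  assumes "prv (Imp (And a b) c)"
  shows "prv (Imp a (Imp b c))"
proof -
  have "prv (Iff (Imp a (Imp b c)) (Imp (And a b) c))"
    using provable_wf[OF assms] by (intro Ax axiom.G5) simp
  then show ?thesis by (rule MP[OF assms iff_elim(2)])
qed

lemma imp_K: "wf a \<Longrightarrow> wf b \<Longrightarrow> prv (Imp a (Imp b a))"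
  using and_elim1 curry by blast

lemma imp_exchange:
  assumes "prv (Imp a (Imp b c))"
  shows "prv (Imp b (Imp a c))"
proof -
  have "wf a" "wf b" using provable_wf[OF assms] by auto
  then show ?thesis using and_comm uncurry[OF assms] imp_trans curry by blast
qed

text \<open>Chaining leaves two copies of \<open>a\<close>, which (G4) contracts.\<close>

lemma imp_S:
  assumes "prv (Imp a (Imp b c))" "prv (Imp a b)"
  shows "prv (Imp a c)"
proof -
  have "wf a" using imp_wf assms by blast
  then show ?thesis
    using imp_trans[OF assms(2) imp_exchange[OF assms(1)]] uncurry and_dup imp_trans by blast
qed

lemma imp_and:
  assumes "prv (Imp c a)" "prv (Imp c b)"
  shows "prv (Imp c (And a b))"
proof -
  have "wf (And a b)" using imp_wf assms by auto
  then have "prv (Imp a (Imp b (And a b)))" using imp_refl curry by blast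
  then show ?thesis using assms imp_S imp_trans by blast
qed

lemma or_intro1: "wf a \<Longrightarrow> wf b \<Longrightarrow> prv (Imp a (Or a b))"
  using imp_exchange[OF imp_refl[of "Imp a b"]] imp_K[of a "Imp b a"] by (auto intro: imp_and)

lemma or_intro2: "wf a \<Longrightarrow> wf b \<Longrightarrow> prv (Imp b (Or a b))"
  using imp_exchange[OF imp_refl[of "Imp b a"]] imp_K[of b "Imp a b"] by (auto intro: imp_and)

text \<open>(G6) splits on the order of \<open>a\<close> and \<open>b\<close>: under
  \<open>Imp a b\<close> the first half of the disjunction yields \<open>b\<close>, under
  \<open>Imp b a\<close> the second half yields \<open>a\<close>.\<close>

lemma or_elim:
  assumes "prv (Imp a c)" "prv (Imp b c)"
  shows "prv (Imp (Or a b) c)"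
proof -
  have w: "wf a" "wf b" "wf c" using imp_wf assms by auto
  have "prv (Imp (Or a b) (Imp (Imp a b) b))" using w by (auto intro!: and_elim1)
  then have 1: "prv (Imp (Or a b) (Imp (Imp a b) c))"
    using assms(2) imp_trans uncurry curry by blast
  have "prv (Imp (Or a b) (Imp (Imp b a) a))" using w by (auto intro!: and_elim2)
  then have 2: "prv (Imp (Or a b) (Imp (Imp b a) c))"
    using assms(1) imp_trans uncurry curry by blast
  have "prv (Imp (Imp (Imp a b) c) (Imp (Imp (Imp b a) c) c))"
    using w by (auto intro!: Ax axiom.G6)
  then show ?thesis using 1 2 imp_trans imp_S by blast
qed

text \<open>(G6) with the disjunction itself as conclusion; its two premises are disjunction
  introductions.\<close>

lemma linearity:
  assumes "wf a" "wf b"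
  shows "prv (Or (Imp a b) (Imp b a))"
proof -
  let ?c = "Or (Imp a b) (Imp b a)"
  have "prv (Imp (Imp (Imp a b) ?c) (Imp (Imp (Imp b a) ?c) ?c))"
    using assms by (intro Ax axiom.G6) simp
  moreover have "prv (Imp (Imp a b) ?c)" "prv (Imp (Imp b a) ?c)"
    using assms or_intro1[of "Imp a b" "Imp b a"] or_intro2[of "Imp a b" "Imp b a"] by simp_all
  ultimately show ?thesis using MP by metis
qed

text \<open>Contraction, through \<open>imp_S\<close>, lets both premises of modus ponens use
  \<open>\<chi>\<close>. Generalization causes no trouble because \<open>\<chi>\<close> is closed,
  so (G\<forall>2) applies.\<close>

lemma deduction:
  assumes "provable L A (insert \<chi> T) \<phi>" and \<chi>: "sentence L A \<chi>"
  shows "prv (Imp \<chi> \<phi>)"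
  using assms(1)
proof (induction rule: provable.induct)
  case (Hyp \<phi>)
  show ?case
  proof (cases "\<phi> = \<chi>")
    case True
    then show ?thesis using \<chi> imp_refl by (auto simp: sentence_def)
  next
    case False
    then have "prv \<phi>" using Hyp by (auto intro: provable.Hyp)
    then show ?thesis using MP[OF _ imp_K] \<chi> provable_wf by (simp add: sentence_def)
  qed
next
  case (Ax \<phi>)
  then have "prv \<phi>" by (rule provable.Ax)
  then show ?case using MP[OF _ imp_K] \<chi> provable_wf by (simp add: sentence_def)
next
  case (MP \<phi> \<psi>)
  then show ?case using imp_S by simp
next
  case (Gen \<phi> x)
  have "axiom A (Imp (All x (Imp \<chi> \<phi>)) (Imp \<chi> (All x \<phi>)))"
    using \<chi> by (auto simp: sentence_def intro: GAll2)
  then have "prv (Imp (All x (Imp \<chi> \<phi>)) (Imp \<chi> (All x \<phi>)))"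
    using provable_wf[OF Gen.IH] by (intro Ax) simp_all
  then show ?case by (rule MP[OF provable.Gen[OF Gen.IH]])
qed

lemma disj_intro:
  "wf \<rho> \<Longrightarrow> (\<And>d. d \<in> set ds \<Longrightarrow> wf d) \<Longrightarrow> d \<in> insert \<rho> (set ds) \<Longrightarrow> prv (Imp d (disj ds \<rho>))"
proof (induction ds)
  case Nil
  then show ?case using imp_refl by auto
next
  case (Cons a ds)
  have w: "wf a" "wf (disj ds \<rho>)" using Cons.prems by (auto intro: wf_disj)
  show ?case
  proof (cases "d = a")
    case True
    then show ?thesis using w or_intro1 by auto
  next
    case False
    then have "prv (Imp d (disj ds \<rho>))" using Cons by auto
    then show ?thesis using imp_trans or_intro2[OF w] by auto
  qed
qed

lemma disj_elim:
  "(\<And>d. d \<in> insert \<rho> (set ds) \<Longrightarrow> prv (Imp d \<chi>)) \<Longrightarrow> prv (Imp (disj ds \<rho>) \<chi>)"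
proof (induction ds)
  case (Cons a ds)
  then show ?case using or_elim[of a \<chi> "disj ds \<rho>"] by auto
qed auto

lemma disj_mono:
  assumes "set ds \<subseteq> set es" "wf \<rho>" "\<And>d. d \<in> set es \<Longrightarrow> wf d"
  shows "prv (Imp (disj ds \<rho>) (disj es \<rho>))"
  using assms by (auto intro!: disj_elim disj_intro)

lemma or_provable_cases:
  assumes "prv (Or a b)" "sentence L A a" "sentence L A b"
    and "provable L A (insert a T) \<phi>" "provable L A (insert b T) \<phi>"
  shows "prv \<phi>"
  by (rule MP[OF assms(1) or_elim[OF deduction[OF assms(4,2)] deduction[OF assms(5,3)]]])

text \<open>Replace \<open>c\<close> by a fresh variable throughout the derivation, generalize it,
  rename it to \<open>x\<close>, and let (G\<forall>3) move the quantifier onto the second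
  disjunct.\<close>

lemma or_generalize_fresh_constant:
  assumes prem: "prv (Or \<theta> (subst x (Fn c []) \<phi>))"
    and \<theta>: "sentence L A \<theta>" and \<phi>: "sentence L A (All x \<phi>)"
    and fresh: "c \<notin> set1_fm \<theta>" "c \<notin> set1_fm \<phi>" "\<And>\<psi>. \<psi> \<in> T \<Longrightarrow> c \<notin> set1_fm \<psi>"
  shows "prv (Or \<theta> (All x \<phi>))"
proof -
  \<comment> \<open>Undefined at \<open>c\<close> alone, so the translation fixes
    \<open>\<theta>\<close>, \<open>\<phi>\<close> and every member of \<open>T\<close>.\<close>
  define h where "h g = (if g = c then None else Some g)" for g
  have id: "tr h y \<psi> = \<psi>" if "c \<notin> set1_fm \<psi>" for y and \<psi> :: "('f, 'p) fm"
    using that by (auto simp: h_def intro!: tr_id)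
  have "sym_map L L h" by (simp add: sym_map_def h_def)
  obtain F where F: "finite F"
    "\<forall>y. y \<notin> F \<longrightarrow> prv (tr h y (Or \<theta> (subst x (Fn c []) \<phi>)))"
    using provable_tr[OF prem \<open>sym_map L L h\<close>, of T] fresh(3) id by metis
  have "finite (F \<union> vars_fm \<phi> \<union> vars_fm \<theta> \<union> {x})" using F(1) by (simp add: finite_vars_fm)
  from ex_new_if_finite[OF infinite_UNIV_nat this]
  obtain y where y: "y \<notin> F \<union> vars_fm \<phi> \<union> vars_fm \<theta> \<union> {x}" ..
  have "prv (Or \<theta> (subst x (Var y) \<phi>))"
    using F(2) y by (auto simp: id fresh tr_subst h_def)
  then have all: "prv (All y (Or \<theta> (subst x (Var y) \<phi>)))" by (rule Gen)
  have \<theta>y: "y \<notin> free_vars \<theta>" using \<theta> by (simp add: sentence_def)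
  \<comment> \<open>Instantiating \<open>y\<close> with \<open>x\<close> by (G\<forall>1) restores
    \<open>\<phi>\<close>.\<close>
  have eq: "subst y (Var x) (Or \<theta> (subst x (Var y) \<phi>)) = Or \<theta> \<phi>"
    using y by (simp add: subst_back subst_id \<theta>y)
  have "substitutable y (Var x) (Or \<theta> (subst x (Var y) \<phi>))"
    using y by (simp add: substitutable_back substitutable_if_not_free \<theta>y)
  then have "axiom A (Imp (All y (Or \<theta> (subst x (Var y) \<phi>))) (Or \<theta> \<phi>))"
    by (simp only: GAll1[of y "Var x" "Or \<theta> (subst x (Var y) \<phi>)" A, unfolded eq])
  moreover have "wf (Imp (All y (Or \<theta> (subst x (Var y) \<phi>))) (Or \<theta> \<phi>))"
    using provable_wf[OF all] \<phi> by (simp add: sentence_def)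
  ultimately have "prv (Imp (All y (Or \<theta> (subst x (Var y) \<phi>))) (Or \<theta> \<phi>))" by (rule Ax)
  then have "prv (All x (Or \<theta> \<phi>))" by (rule Gen[OF MP[OF all]])
  moreover have "prv (Imp (All x (Or \<theta> \<phi>)) (Or \<theta> (All x \<phi>)))"
    using \<theta> \<phi> by (intro Ax GAll3) (simp_all add: sentence_def)
  ultimately show ?thesis by (rule MP)
qed

end

section \<open>Witness constants\<close>

text \<open>Codes make formulas of the extension available as names of its own constants. The shape
  separates old head symbols (\<open>Rel\<close>) from new ones (\<open>And\<close>);
  \<open>undefined\<close> is filler. What counts is injectivity and growth in size, not
  well-formedness.\<close>

primrec enc_tm :: "('f, 'p) ext_sym tm \<Rightarrow> ('f, 'p) fm" where
  "enc_tm (Var n) = All n Bot"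
| "enc_tm (Fn g ts) =
    Imp (case g of Inl f \<Rightarrow> Rel undefined [Fn f []] | Inr \<psi> \<Rightarrow> And \<psi> \<psi>)
      (foldr And (map enc_tm ts) Bot)"

text \<open>Atoms and implications both become \<open>Imp\<close>; the left component,
  \<open>Rel p []\<close> or \<open>Bot\<close>, separates them.\<close>

primrec enc :: "(('f, 'p) ext_sym, 'p) fm \<Rightarrow> ('f, 'p) fm" where
  "enc Bot = Bot"
| "enc (Cst r) = Cst r"
| "enc (Rel p ts) = Imp (Rel p []) (foldr And (map enc_tm ts) Bot)"
| "enc (And \<phi> \<psi>) = And (enc \<phi>) (enc \<psi>)"
| "enc (Imp \<phi> \<psi>) = Imp Bot (And (enc \<phi>) (enc \<psi>))"
| "enc (All x \<phi>) = All x (enc \<phi>)"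
| "enc (Ex x \<phi>) = Ex x (enc \<phi>)"

lemma foldr_And_inject: "foldr And xs Bot = foldr And ys Bot \<Longrightarrow> xs = ys"
proof (induction xs arbitrary: ys)
  case Nil
  then show ?case by (cases ys) auto
next
  case (Cons x xs)
  then show ?case by (cases ys) auto
qed

lemma enc_tm_inject: "enc_tm s = enc_tm t \<Longrightarrow> s = t"
proof (induction s arbitrary: t)
  case (Var n)
  then show ?case by (cases t) auto
next
  case (Fn g ss)
  then obtain k ts where t: "t = Fn k ts" by (cases t) auto
  have "map enc_tm ss = map enc_tm ts" using Fn.prems by (simp add: t foldr_And_inject)
  then have "ss = ts" by (rule list.inj_map_strong[rotated]) (rule Fn.IH)
  moreover have "g = k" using Fn.prems by (auto simp: t split: sum.splits)
  ultimately show ?case by (simp add: t)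
qed

lemma enc_inject: "enc \<phi> = enc \<psi> \<Longrightarrow> \<phi> = \<psi>"
proof (induction \<phi> arbitrary: \<psi>)
  case (Rel p ts)
  then obtain q us where \<psi>: "\<psi> = Rel q us" "p = q" by (cases \<psi>) auto
  have "map enc_tm ts = map enc_tm us" using Rel.prems by (simp add: \<psi> foldr_And_inject)
  then have "ts = us" by (rule list.inj_map_strong[rotated]) (rule enc_tm_inject)
  then show ?case by (simp add: \<psi>)
next
  case (Imp a b)
  then show ?case by (cases \<psi>) auto
next
  case (And a b)
  then show ?case by (cases \<psi>) auto
next
  case (All x a)
  then show ?case by (cases \<psi>) auto
next
  case (Ex x a)
  then show ?case by (cases \<psi>) auto
next
  case Bot
  then show ?case by (cases \<psi>) auto
next
  case (Cst r)
  then show ?case by (cases \<psi>) auto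
qed

lemma size_foldr_And: "\<phi> \<in> set xs \<Longrightarrow> size \<phi> < size (foldr And xs Bot)"
  by (induction xs) auto

lemma size_enc_tm: "Inr \<psi> \<in> set_tm t \<Longrightarrow> size \<psi> < size (enc_tm t)"
proof (induction t)
  case (Fn g ts)
  show ?case
  proof (cases "g = Inr \<psi>")
    case True
    then show ?thesis by simp
  next
    case False
    then obtain t where t: "t \<in> set ts" "Inr \<psi> \<in> set_tm t" using Fn.prems by auto
    then have "size \<psi> < size (enc_tm t)" using Fn.IH by blast
    also have "\<dots> < size (foldr And (map enc_tm ts) Bot)" using t by (intro size_foldr_And) simp
    finally show ?thesis by simp
  qed
qed simp

text \<open>Each new symbol of a formula is copied whole into the code.\<close>

lemma size_enc: "Inr \<psi> \<in> set1_fm \<phi> \<Longrightarrow> size \<psi> < size (enc \<phi>)"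
proof (induction \<phi>)
  case (Rel p ts)
  then obtain t where t: "t \<in> set ts" "Inr \<psi> \<in> set_tm t" by auto
  then have "size \<psi> < size (enc_tm t)" using size_enc_tm by blast
  also have "\<dots> < size (foldr And (map enc_tm ts) Bot)" using t by (intro size_foldr_And) simp
  finally show ?case by simp
qed auto

text \<open>
  The witness constant \<open>Inr (enc \<xi>)\<close> of \<open>\<xi> = \<forall>x \<phi>\<close> is larger than all new symbols of \<open>\<xi>\<close>,
  so a witness constant of maximal size in a finite set of universal sentences occurs in
  no other sentence of that set.
\<close>

fun wit :: "(('f, 'p) ext_sym, 'p) fm \<Rightarrow> (('f, 'p) ext_sym, 'p) fm" where
  "wit (All x \<phi>) = subst x (Fn (Inr (enc (All x \<phi>))) []) \<phi>"
| "wit \<phi> = \<phi>"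

lemma funs_wit: "set1_fm (wit \<xi>) \<subseteq> insert (Inr (enc \<xi>)) (set1_fm \<xi>)"
  using funs_subst by (cases \<xi>) fastforce+

section \<open>Decisions on universal sentences\<close>

text \<open>A multiple-conclusion consequence relation with \<open>D\<close> on the right, always
  joined by \<open>\<rho>\<close>; lists keep each disjunction finite, and the empty one is
  \<open>\<rho>\<close>.\<close>

definition entails_some ::
    "('f, 'p) lang \<Rightarrow> real set \<Rightarrow> ('f, 'p) fm \<Rightarrow> ('f, 'p) fm set \<Rightarrow> ('f, 'p) fm set \<Rightarrow> bool" where
  "entails_some L A \<rho> T D \<longleftrightarrow> (\<exists>ds. set ds \<subseteq> D \<and> provable L A T (disj ds \<rho>))"

lemma entails_some_mono:
  "entails_some L A \<rho> T D \<Longrightarrow> T \<subseteq> U \<Longrightarrow> D \<subseteq> E \<Longrightarrow> entails_some L A \<rho> U E"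
  unfolding entails_some_def using provable_mono by (meson order_trans)

lemma entails_some_finite_subset:
  "entails_some L A \<rho> T D \<Longrightarrow> \<exists>X. finite X \<and> X \<subseteq> T \<and> entails_some L A \<rho> X D"
  unfolding entails_some_def using provable_finite_subset by meson

text \<open>Both disjunctions weaken to that of the concatenated list, to which proof by cases
  applies.\<close>

lemma entails_some_cases:
  assumes T: "is_theory L A T" and D: "\<And>d. d \<in> D \<Longrightarrow> wf_fm L A d" and \<rho>: "wf_fm L A \<rho>"
    and ab: "provable L A T (Or a b)" "sentence L A a" "sentence L A b"
    and a: "entails_some L A \<rho> (insert a T) D" and b: "entails_some L A \<rho> (insert b T) D"
  shows "entails_some L A \<rho> T D"
proof -
  obtain ds es where ds: "set ds \<subseteq> D" "provable L A (insert a T) (disj ds \<rho>)"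
    and es: "set es \<subseteq> D" "provable L A (insert b T) (disj es \<rho>)"
    using a b by (auto simp: entails_some_def)
  have thy: "is_theory L A (insert a T)" "is_theory L A (insert b T)"
    using T ab by (auto simp: is_theory_def)
  have "provable L A (insert a T) (disj (ds @ es) \<rho>)"
    by (rule MP[OF ds(2) disj_mono[OF thy(1)]]) (use ds es D \<rho> in auto)
  moreover have "provable L A (insert b T) (disj (ds @ es) \<rho>)"
    by (rule MP[OF es(2) disj_mono[OF thy(2)]]) (use ds es D \<rho> in auto)
  ultimately have "provable L A T (disj (ds @ es) \<rho>)"
    by (rule or_provable_cases[OF T ab])
  then show ?thesis using ds es unfolding entails_some_def by (intro exI[of _ "ds @ es"]) auto
qed

text \<open>Rearranging brings \<open>d\<close> to the outermost right disjunct, the place of the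
  witness instance in \<open>or_generalize_fresh_constant\<close>.\<close>

lemma entails_some_insert:
  assumes T: "is_theory L A T" and D: "\<And>e. e \<in> D \<Longrightarrow> wf_fm L A e"
    and \<rho>: "wf_fm L A \<rho>" and d: "wf_fm L A d"
    and ent: "entails_some L A \<rho> T (insert d D)"
  shows "\<exists>es. set es \<subseteq> D \<and> provable L A T (Or (disj es \<rho>) d)"
proof -
  obtain ds where ds: "set ds \<subseteq> insert d D" "provable L A T (disj ds \<rho>)"
    using ent by (auto simp: entails_some_def)
  \<comment> \<open>The filter can drop no entry other than \<open>d\<close>.\<close>
  define es where "es = filter (\<lambda>e. e \<in> D) ds"
  have es: "wf_fm L A e" if "e \<in> set es" for e using that D by (simp add: es_def)
  have w: "wf_fm L A (disj es \<rho>)" by (rule wf_disj[OF \<rho> es])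
  have "provable L A T (Imp e (Or (disj es \<rho>) d))" if "e \<in> insert \<rho> (set ds)" for e
  proof (cases "e \<in> insert \<rho> (set es)")
    case True
    then have "provable L A T (Imp e (disj es \<rho>))" using disj_intro[OF T \<rho> es] by blast
    then show ?thesis by (rule imp_trans[OF T _ or_intro1[OF T w d]])
  next
    case False
    then have "e = d" using that ds by (auto simp: es_def)
    then show ?thesis using or_intro2[OF T w d] by simp
  qed
  then have "provable L A T (Imp (disj ds \<rho>) (Or (disj es \<rho>) d))" by (rule disj_elim[OF T])
  then have "provable L A T (Or (disj es \<rho>) d)" by (rule MP[OF ds(2)])
  then show ?thesis by (intro exI[of _ es]) (auto simp: es_def)
qed

text \<open>
  \<open>S\<close> is a choice of decisions on \<open>F\<close>: the sentences in \<open>S\<close> become axioms, the witness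
  instances of the others join the disjunction.
\<close>

definition refutes ::
    "(('f, 'p) ext_sym, 'p) lang \<Rightarrow> real set \<Rightarrow> (('f, 'p) ext_sym, 'p) fm \<Rightarrow>
      (('f, 'p) ext_sym, 'p) fm set \<Rightarrow> (('f, 'p) ext_sym, 'p) fm set \<Rightarrow> bool" where
  "refutes L A \<rho> F T \<longleftrightarrow> (\<forall>S \<subseteq> F. entails_some L A \<rho> (T \<union> S) (wit ` (F - S)))"

definition universals :: "('f, 'p) lang \<Rightarrow> real set \<Rightarrow> ('f, 'p) fm set" where
  "universals L A = {\<xi>. sentence L A \<xi> \<and> (\<exists>x \<phi>. \<xi> = All x \<phi>)}"

section \<open>Refutation by finite sets of decisions\<close>

context
  fixes L :: "(('f, 'p) ext_sym, 'p) lang" and A :: "real set"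
    and \<rho> :: "(('f, 'p) ext_sym, 'p) fm"
  assumes new_constants: "range Inr \<subseteq> constants L" and \<rho>: "sentence L A \<rho>"
begin

lemma wf_\<rho>: "wf_fm L A \<rho>"
  using \<rho> by (simp add: sentence_def)

lemma sentence_subst:
  assumes "sentence L A (All x \<phi>)" "c \<in> constants L"
  shows "sentence L A (subst x (Fn c []) \<phi>)"
  using assms by (auto simp: sentence_def constants_def free_vars_subst_closed wf_subst)

lemma sentence_wit:
  assumes "\<xi> \<in> universals L A"
  shows "sentence L A (wit \<xi>)"
proof -
  obtain x \<phi> where "\<xi> = All x \<phi>" "sentence L A (All x \<phi>)"
    using assms by (auto simp: universals_def)
  then show ?thesis using new_constants by (auto intro: sentence_subst)
qed

lemma wf_wit: "F \<subseteq> universals L A \<Longrightarrow> d \<in> wit ` F \<Longrightarrow> wf_fm L A d"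
  using sentence_wit by (auto simp: sentence_def)

lemma theory_Un_universals:
  "is_theory L A T \<Longrightarrow> S \<subseteq> universals L A \<Longrightarrow> is_theory L A (T \<union> S)"
  by (auto simp: is_theory_def universals_def)

text \<open>A choice of decisions on the union restricts to one on \<open>F\<close> and one on
  \<open>G\<close>; the two resulting consequences weaken to a common form and are joined by cases
  on \<open>a\<close> and \<open>b\<close>.\<close>

lemma refutes_cases:
  assumes T: "is_theory L A T" and FG: "F \<subseteq> universals L A" "G \<subseteq> universals L A"
    and ab: "provable L A T (Or a b)" "sentence L A a" "sentence L A b"
    and a: "refutes L A \<rho> F (insert a T)" and b: "refutes L A \<rho> G (insert b T)"
  shows "refutes L A \<rho> (F \<union> G) T"
  unfolding refutes_def
proof (intro allI impI)
  fix S assume S: "S \<subseteq> F \<union> G"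
  let ?D = "wit ` (F \<union> G - S)"
  have "entails_some L A \<rho> (insert a T \<union> (S \<inter> F)) (wit ` (F - S \<inter> F))"
    using a by (simp add: refutes_def)
  then have 1: "entails_some L A \<rho> (insert a (T \<union> S)) ?D"
    by (rule entails_some_mono) auto
  have "entails_some L A \<rho> (insert b T \<union> (S \<inter> G)) (wit ` (G - S \<inter> G))"
    using b by (simp add: refutes_def)
  then have 2: "entails_some L A \<rho> (insert b (T \<union> S)) ?D"
    by (rule entails_some_mono) auto
  show "entails_some L A \<rho> (T \<union> S) ?D"
  proof (rule entails_some_cases[OF _ _ wf_\<rho> _ ab(2,3) 1 2])
    show "is_theory L A (T \<union> S)" using T S FG by (intro theory_Un_universals) auto
    show "wf_fm L A d" if "d \<in> ?D" for d
      by (rule wf_wit[OF _ that]) (use FG in auto)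
    show "provable L A (T \<union> S) (Or a b)" by (rule provable_mono[OF ab(1)]) simp
  qed
qed

text \<open>A choice that accepts \<open>\<xi>\<close> is covered by the refutation of the enlarged
  theory; one that rejects it puts the provable \<open>wit \<xi>\<close> into the
  disjunction.\<close>

lemma refutes_witnessed:
  assumes T: "is_theory L A T" and F: "F \<subseteq> universals L A" and \<xi>: "\<xi> \<in> universals L A"
    and wit: "provable L A T (wit \<xi>)" and ref: "refutes L A \<rho> F (insert \<xi> T)"
  shows "refutes L A \<rho> (insert \<xi> F) T"
  unfolding refutes_def
proof (intro allI impI)
  fix S assume S: "S \<subseteq> insert \<xi> F"
  show "entails_some L A \<rho> (T \<union> S) (wit ` (insert \<xi> F - S))"
  proof (cases "\<xi> \<in> S")
    case True
    have "entails_some L A \<rho> (insert \<xi> T \<union> (S \<inter> F)) (wit ` (F - S \<inter> F))"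
      using ref by (simp add: refutes_def)
    then show ?thesis by (rule entails_some_mono) (use True in auto)
  next
    case False
    have thy: "is_theory L A (T \<union> S)" using T S F \<xi> by (intro theory_Un_universals) auto
    have "wf_fm L A (wit \<xi>)" using sentence_wit[OF \<xi>] by (simp add: sentence_def)
    then have "provable L A (T \<union> S) (Or (wit \<xi>) \<rho>)"
      by (intro MP[OF _ or_intro1[OF thy _ wf_\<rho>]] provable_mono[OF wit]) auto
    then show ?thesis
      unfolding entails_some_def using False by (intro exI[of _ "[wit \<xi>]"]) simp
  qed
qed

text \<open>For a choice \<open>S\<close> on \<open>F\<close>, rejecting \<open>\<xi>\<close> yields
  \<open>Or \<theta> (wit \<xi>)\<close>, and freshness of the witness turns this into
  \<open>Or \<theta> \<xi>\<close>. The case \<open>\<theta>\<close> is immediate; the case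
  \<open>\<xi>\<close> is the choice that accepts \<open>\<xi>\<close>.\<close>

lemma refutes_eliminate_largest:
  assumes T: "is_theory L A T" and F: "insert \<xi> F \<subseteq> universals L A"
    and "\<xi> \<notin> F" and max: "\<And>\<zeta>. \<zeta> \<in> F \<Longrightarrow> size (enc \<zeta>) \<le> size (enc \<xi>)"
    and fresh: "\<And>\<psi> c. \<psi> \<in> insert \<rho> T \<Longrightarrow> Inr c \<notin> set1_fm \<psi>"
    and ref: "refutes L A \<rho> (insert \<xi> F) T"
  shows "refutes L A \<rho> F T"
  unfolding refutes_def
proof (intro allI impI)
  fix S assume S: "S \<subseteq> F"
  let ?D = "wit ` (F - S)" and ?c = "Inr (enc \<xi>)"
  have thy: "is_theory L A (T \<union> S)" using T S F by (intro theory_Un_universals) auto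
  have D: "wf_fm L A d" if "d \<in> ?D" for d
    by (rule wf_wit[OF _ that]) (use F in auto)
  obtain x \<phi> where \<xi>: "\<xi> = All x \<phi>" "sentence L A \<xi>" using F by (auto simp: universals_def)
  \<comment> \<open>New symbols of a sentence are smaller than its code, which here is no larger
    than that of \<open>\<xi>\<close>.\<close>
  have fresh_F: "?c \<notin> set1_fm \<zeta>" if "\<zeta> \<in> insert \<xi> F" for \<zeta>
    using size_enc[of "enc \<xi>" \<zeta>] max that by fastforce
  \<comment> \<open>\<open>wit \<zeta>\<close> adds at most the constant of \<open>\<zeta>\<close>,
    distinct from \<open>?c\<close> because \<open>enc\<close> is injective.\<close>
  have fresh_D: "?c \<notin> set1_fm d" if d: "d \<in> ?D" for d
  proof -
    obtain \<zeta> where \<zeta>: "d = wit \<zeta>" "\<zeta> \<in> F" using d by auto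
    then have "enc \<zeta> \<noteq> enc \<xi>" using enc_inject \<open>\<xi> \<notin> F\<close> by blast
    then show ?thesis using funs_wit[of \<zeta>] fresh_F \<zeta> by auto
  qed
  have "wf_fm L A (wit \<xi>)" using sentence_wit F by (simp add: sentence_def)
  moreover have "entails_some L A \<rho> (T \<union> S) (insert (wit \<xi>) ?D)"
  proof -
    have "entails_some L A \<rho> (T \<union> S) (wit ` (insert \<xi> F - S))"
      using ref S by (auto simp: refutes_def)
    then show ?thesis by (rule entails_some_mono) auto
  qed
  ultimately obtain es where es: "set es \<subseteq> ?D" "provable L A (T \<union> S) (Or (disj es \<rho>) (wit \<xi>))"
    using entails_some_insert[OF thy D wf_\<rho>] by blast
  let ?\<theta> = "disj es \<rho>"
  have es_sentence: "sentence L A d" if "d \<in> set es" for d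
    using that es F sentence_wit by auto
  have \<theta>: "sentence L A ?\<theta>"
    using es_sentence \<rho> by (induction es) (auto simp: sentence_def)
  have "?c \<notin> set1_fm ?\<theta>"
    using es(1) fresh_D fresh[of \<rho>] by (induction es) auto
  moreover have "?c \<notin> set1_fm \<psi>" if "\<psi> \<in> T \<union> S" for \<psi>
    using that fresh fresh_F S by auto
  ultimately have "provable L A (T \<union> S) (Or ?\<theta> \<xi>)"
    using or_generalize_fresh_constant[OF thy, of ?\<theta> x ?c \<phi>] es(2) \<theta> \<xi> fresh_F[of \<xi>] by simp
  moreover have "entails_some L A \<rho> (insert ?\<theta> (T \<union> S)) ?D"
    unfolding entails_some_def using es by (auto intro!: exI[of _ es] Hyp)
  moreover have "entails_some L A \<rho> (insert \<xi> (T \<union> S)) ?D"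
  proof -
    have "entails_some L A \<rho> (T \<union> insert \<xi> S) (wit ` (insert \<xi> F - insert \<xi> S))"
      using ref S unfolding refutes_def by (meson insert_mono)
    then show ?thesis by (rule entails_some_mono) auto
  qed
  ultimately show "entails_some L A \<rho> (T \<union> S) ?D"
    using entails_some_cases[OF thy D wf_\<rho> _ \<theta> \<xi>(2)] by blast
qed

text \<open>Decisions are removed from the largest code downwards; ties are harmless since
  \<open>enc\<close> is injective. With none left, the disjunction is \<open>\<rho>\<close>
  itself.\<close>

lemma refutes_imp_provable:
  assumes "finite F" "F \<subseteq> universals L A" "is_theory L A T"
    and "\<And>\<psi> c. \<psi> \<in> insert \<rho> T \<Longrightarrow> Inr c \<notin> set1_fm \<psi>"
    and "refutes L A \<rho> F T"
  shows "provable L A T \<rho>"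
  using assms
proof (induction F rule: finite_ranking_induct[where f = "\<lambda>\<xi>. size (enc \<xi>)"])
  case empty
  then show ?case by (simp add: refutes_def entails_some_def)
next
  case (insert \<xi> F)
  show ?case
  proof (cases "\<xi> \<in> F")
    case True
    then show ?thesis using insert by (simp add: insert_absorb)
  next
    case False
    have "refutes L A \<rho> F T"
      by (rule refutes_eliminate_largest[OF insert.prems(2,1) False insert.hyps(2) insert.prems(3,4)])
    moreover have "F \<subseteq> universals L A" using insert.prems(1) by simp
    ultimately show ?thesis using insert.IH insert.prems(2,3) by blast
  qed
qed

text \<open>Each of the finitely many choices on \<open>F\<close> uses only finitely many sentences
  of the union, so one member of the chain serves them all.\<close>

lemma refutes_chain:
  assumes "finite F" and C: "C \<noteq> {}" "subset.chain B C" and ref: "refutes L A \<rho> F (\<Union>C)"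
  shows "\<exists>T \<in> C. refutes L A \<rho> F T"
proof -
  have "\<exists>X. finite X \<and> X \<subseteq> \<Union>C \<and> entails_some L A \<rho> (X \<union> S) (wit ` (F - S))"
    if S: "S \<subseteq> F" for S
  proof -
    obtain X where X: "finite X" "X \<subseteq> \<Union>C \<union> S" "entails_some L A \<rho> X (wit ` (F - S))"
      using ref S entails_some_finite_subset unfolding refutes_def by meson
    have "entails_some L A \<rho> ((X \<inter> \<Union>C) \<union> S) (wit ` (F - S))"
      by (rule entails_some_mono[OF X(3)]) (use X in auto)
    then show ?thesis using X(1) by (intro exI[of _ "X \<inter> \<Union>C"]) auto
  qed
  then obtain X where X: "\<And>S. S \<subseteq> F \<Longrightarrow> finite (X S)" "\<And>S. S \<subseteq> F \<Longrightarrow> X S \<subseteq> \<Union>C"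
    "\<And>S. S \<subseteq> F \<Longrightarrow> entails_some L A \<rho> (X S \<union> S) (wit ` (F - S))" by metis
  have "finite (\<Union> (X ` Pow F))" "\<Union> (X ` Pow F) \<subseteq> \<Union>C"
    using \<open>finite F\<close> X by auto
  then obtain T where T: "T \<in> C" "\<Union> (X ` Pow F) \<subseteq> T"
    using finite_subset_Union_chain[OF _ _ C] by metis
  have "entails_some L A \<rho> (T \<union> S) (wit ` (F - S))" if "S \<subseteq> F" for S
    by (rule entails_some_mono[OF X(3)[OF that]]) (use T(2) that in auto)
  then show ?thesis using T(1) by (auto simp: refutes_def)
qed

text \<open>A failure is witnessed by a single finite \<open>F\<close>; with
  \<open>refutes_chain\<close> this carries the property to unions of chains, as Zorn's lemma
  requires.\<close>

definition irrefutable :: "(('f, 'p) ext_sym, 'p) fm set \<Rightarrow> bool" where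
  "irrefutable T \<longleftrightarrow> is_theory L A T \<and>
    (\<forall>F. finite F \<longrightarrow> F \<subseteq> universals L A \<longrightarrow> \<not> refutes L A \<rho> F T)"

lemma maximal_irrefutable:
  assumes "irrefutable T\<^sub>0"
  obtains T where "T\<^sub>0 \<subseteq> T" "irrefutable T" "\<And>U. irrefutable U \<Longrightarrow> T \<subseteq> U \<Longrightarrow> U = T"
proof -
  let ?B = "{T. T\<^sub>0 \<subseteq> T \<and> irrefutable T}"
  have "\<exists>T \<in> ?B. \<forall>U \<in> ?B. T \<subseteq> U \<longrightarrow> U = T"
  proof (rule subset_Zorn_nonempty)
    show "?B \<noteq> {}" using assms by auto
  next
    fix C assume C: "C \<noteq> {}" "subset.chain ?B C"
    then have CB: "C \<subseteq> ?B" by (auto simp: subset.chain_def)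
    have "is_theory L A (\<Union>C)" using CB by (auto simp: irrefutable_def is_theory_def)
    moreover have "\<not> refutes L A \<rho> F (\<Union>C)" if "finite F" "F \<subseteq> universals L A" for F
      using refutes_chain[OF that(1) C] CB that by (auto simp: irrefutable_def)
    moreover have "T\<^sub>0 \<subseteq> \<Union>C" using C(1) CB by blast
    ultimately show "\<Union>C \<in> ?B" by (simp add: irrefutable_def)
  qed
  then obtain T where "T\<^sub>0 \<subseteq> T" "irrefutable T" "\<forall>U \<in> ?B. T \<subseteq> U \<longrightarrow> U = T" by blast
  \<comment> \<open>An irrefutable extension of \<open>T\<close> also contains
    \<open>T\<^sub>0\<close>, so maximality in \<open>?B\<close> is maximality among all irrefutable
    theories.\<close>
  then show ?thesis using that by (metis (mono_tags, lifting) mem_Collect_eq order_trans)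
qed

section \<open>Properties of a maximal irrefutable theory\<close>

context
  fixes T :: "(('f, 'p) ext_sym, 'p) fm set"
  assumes irr: "irrefutable T" and max: "\<And>U. irrefutable U \<Longrightarrow> T \<subseteq> U \<Longrightarrow> U = T"
begin

lemma maximal_theory: "is_theory L A T"
  using irr by (simp add: irrefutable_def)

text \<open>The case \<open>F = {}\<close>, where there is no decision to make.\<close>

lemma maximal_unprovable: "\<not> provable L A T \<rho>"
proof
  assume "provable L A T \<rho>"
  then have "refutes L A \<rho> {} T" by (simp add: refutes_def entails_some_def)
  then show False using irr by (simp add: irrefutable_def)
qed

lemma maximal_not_mem:
  assumes "sentence L A a" "a \<notin> T"
  obtains F where "finite F" "F \<subseteq> universals L A" "refutes L A \<rho> F (insert a T)"
proof -
  have "\<not> irrefutable (insert a T)" using max[of "insert a T"] assms(2) by auto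
  moreover have "is_theory L A (insert a T)"
    using maximal_theory assms(1) by (simp add: is_theory_def)
  ultimately show ?thesis using that by (auto simp: irrefutable_def)
qed

text \<open>If both disjuncts were missing, maximality would give a refutation after adding either
  one, and \<open>refutes_cases\<close> would combine the two into a refutation of
  \<open>T\<close>.\<close>

lemma maximal_prime:
  assumes "provable L A T (Or a b)" "sentence L A a" "sentence L A b"
  shows "a \<in> T \<or> b \<in> T"
proof (rule ccontr)
  assume "\<not> ?thesis"
  then obtain F G where F: "finite F" "F \<subseteq> universals L A" "refutes L A \<rho> F (insert a T)"
    and G: "finite G" "G \<subseteq> universals L A" "refutes L A \<rho> G (insert b T)"
    using assms(2,3) maximal_not_mem by metis
  have "refutes L A \<rho> (F \<union> G) T"
    by (rule refutes_cases[OF maximal_theory F(2) G(2) assms F(3) G(3)])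
  then show False using irr F G by (auto simp: irrefutable_def)
qed

lemma maximal_deductively_complete: "deductively_complete L A T"
  unfolding deductively_complete_def
proof (intro allI impI)
  fix \<phi> \<psi> assume s: "sentence L A \<phi>" "sentence L A \<psi>"
  then have "provable L A T (Or (Imp \<phi> \<psi>) (Imp \<psi> \<phi>))"
    by (intro linearity[OF maximal_theory]) (simp_all add: sentence_def)
  then have "Imp \<phi> \<psi> \<in> T \<or> Imp \<psi> \<phi> \<in> T"
    using s by (intro maximal_prime) (auto simp: sentence_def)
  then show "provable L A T (Imp \<phi> \<psi>) \<or> provable L A T (Imp \<psi> \<phi>)" by (auto intro: Hyp)
qed

lemma maximal_deductively_Henkin: "deductively_Henkin L A T"
  unfolding deductively_Henkin_def
proof (intro allI impI)
  fix x \<phi> assume s: "sentence L A (All x \<phi>)" and np: "\<not> provable L A T (All x \<phi>)"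
  let ?\<xi> = "All x \<phi>" and ?c = "Inr (enc (All x \<phi>))"
  have \<xi>: "?\<xi> \<in> universals L A" using s by (simp add: universals_def)
  have "?\<xi> \<notin> T" using np by (auto intro: Hyp)
  then obtain F where F: "finite F" "F \<subseteq> universals L A" "refutes L A \<rho> F (insert ?\<xi> T)"
    using maximal_not_mem[OF s] by blast
  have "\<not> provable L A T (wit ?\<xi>)"
  proof
    \<comment> \<open>A provable witness instance would turn the refutation of
      \<open>insert ?\<xi> T\<close> into one of \<open>T\<close>.\<close>
    assume "provable L A T (wit ?\<xi>)"
    then have "refutes L A \<rho> (insert ?\<xi> F) T"
      by (rule refutes_witnessed[OF maximal_theory F(2) \<xi> _ F(3)])
    then show False using irr F \<xi> by (auto simp: irrefutable_def)
  qed
  moreover have "?c \<in> constants L" using new_constants by auto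
  ultimately show "\<exists>c \<in> constants L. \<not> provable L A T (subst x (Fn c []) \<phi>)" by auto
qed

end

end

section \<open>The extended language\<close>

definition henkin_lang :: "('f, 'p) lang \<Rightarrow> (('f, 'p) ext_sym, 'p) lang" where
  "henkin_lang L = \<lparr>funs = Inl ` funs L \<union> range Inr, farity = case_sum (farity L) (\<lambda>_. 0),
    rels = rels L, rarity = rarity L\<rparr>"

lemma henkin_lang_extends: "lang_extends (henkin_lang L) L"
  by (auto simp: lang_extends_def henkin_lang_def)

lemma constants_henkin_lang: "range Inr \<subseteq> constants (henkin_lang L)"
  by (auto simp: constants_def henkin_lang_def)

lemma wf_lift_tm: "wf_tm L t \<Longrightarrow> wf_tm (henkin_lang L) (map_tm Inl t)"
  by (induction t) (auto simp: henkin_lang_def)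

lemma wf_lift: "wf_fm L A \<phi> \<Longrightarrow> wf_fm (henkin_lang L) A (lift_fm \<phi>)"
  by (induction \<phi>) (auto simp: wf_lift_tm, auto simp: henkin_lang_def)

lemma vars_map_tm: "vars_tm (map_tm f t) = vars_tm t"
  by (induction t) auto

lemma free_vars_map_fm: "free_vars (map_fm f g \<phi>) = free_vars \<phi>"
  by (induction \<phi>) (auto simp: vars_map_tm)

lemma sentence_lift: "sentence L A \<phi> \<Longrightarrow> sentence (henkin_lang L) A (lift_fm \<phi>)"
  by (simp add: sentence_def wf_lift free_vars_map_fm)

lemma tr_lift_tm: "tr_tm (case_sum Some (\<lambda>_. None)) y (map_tm Inl t) = t"
  by (induction t) (auto intro: map_idI)

lemma tr_lift: "tr (case_sum Some (\<lambda>_. None)) y (lift_fm \<phi>) = \<phi>"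
  by (induction \<phi>) (auto simp: tr_lift_tm intro!: map_idI)

lemma lift_rbar: "lift_fm (rbar r) = rbar r"
  by (simp add: rbar_def)

text \<open>Conservativity: all new constants become one variable, chosen to suit the derivation,
  and lifted formulas contain none of them, so they translate back to their originals.\<close>

lemma provable_lift_imp_provable:
  fixes L :: "('f, 'p) lang"
  assumes "provable (henkin_lang L) A (lift_fm ` T) (lift_fm \<phi>)"
  shows "provable L A T \<phi>"
proof -
  let ?h = "case_sum Some (\<lambda>_. None) :: ('f, 'p) ext_sym \<Rightarrow> 'f option"
  have "sym_map (henkin_lang L) L ?h"
    by (auto simp: sym_map_def henkin_lang_def)
  moreover have "tr ?h y \<psi> \<in> T" if "\<psi> \<in> lift_fm ` T" for \<psi> y
    using that by (auto simp: tr_lift)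
  ultimately obtain F where F: "finite F"
    "\<forall>y. y \<notin> F \<longrightarrow> provable L A T (tr ?h y (lift_fm \<phi>))"
    using provable_tr[OF assms] by metis
  from ex_new_if_finite[OF infinite_UNIV_nat F(1)] obtain y where "y \<notin> F" ..
  then show ?thesis using F(2) by (auto simp: tr_lift)
qed

theorem theorem3p9:
  fixes L :: "('f, 'p) lang"
    and A :: "real set"
    and T :: "('f, 'p) fm set"
  assumes "A \<subseteq> {0<..<1}"
    and "\<forall>x \<in> {0..1}. \<not> x islimpt A"
    and "is_theory L A T"
    and "strongly_consistent L A T"
  shows "\<exists>(L' :: (('f, 'p) ext_sym, 'p) lang) T'.
           lang_extends L' L \<and> is_theory L' A T' \<and> lift_fm ` T \<subseteq> T' \<and>
           strongly_consistent L' A T' \<and>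
           deductively_complete L' A T' \<and>
           deductively_Henkin L' A T'"
proof -
  \<comment> \<open>An infinite subset of the compact unit interval has a limit point there.\<close>
  have "finite A"
  proof (rule ccontr)
    assume "infinite A"
    moreover have "A \<subseteq> {0..1}" using assms(1) by auto
    ultimately show False
      using Heine_Borel_imp_Bolzano_Weierstrass[OF compact_Icc] assms(2) by metis
  qed
  \<comment> \<open>The least value is nearest to truth, so by (RG2a) \<open>rbar m\<close> follows
    from every constant that must stay unprovable. Inserting 1 covers empty
    \<open>A\<close>.\<close>
  define m where "m = Min (insert 1 A)"
  have m: "m \<in> insert 1 A" "\<And>r. r \<in> insert 1 A \<Longrightarrow> m \<le> r"
    using Min_in[of "insert 1 A"] Min_le[of "insert 1 A"] \<open>finite A\<close> unfolding m_def by blast+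
  let ?L = "henkin_lang L" and ?T = "lift_fm ` T :: (('f, 'p) ext_sym, 'p) fm set"
  define \<rho> :: "(('f, 'p) ext_sym, 'p) fm" where "\<rho> = rbar m"
  have \<rho>: "sentence ?L A \<rho>" unfolding \<rho>_def using m(1) by (intro sentence_rbar) auto
  note ctx = constants_henkin_lang[of L] \<rho>
  have thy: "is_theory ?L A ?T" using assms(3) sentence_lift by (auto simp: is_theory_def)
  have unprovable: "\<not> provable ?L A ?T \<rho>"
    using assms(4) m(1) provable_lift_imp_provable[of L A T "rbar m"]
    by (auto simp: strongly_consistent_def \<rho>_def lift_rbar)
  \<comment> \<open>\<open>\<rho>\<close> contains no function symbols and lifted sentences only old
    ones.\<close>
  have fresh: "Inr c \<notin> set1_fm \<psi>" if "\<psi> \<in> insert \<rho> ?T" for \<psi> c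
    using that by (auto simp: fm.set_map \<rho>_def rbar_def split: if_splits)
  have "\<not> refutes ?L A \<rho> F ?T" if "finite F" "F \<subseteq> universals ?L A" for F
    using refutes_imp_provable[OF ctx that thy fresh] unprovable by blast
  then have "irrefutable ?L A \<rho> ?T" using thy unfolding irrefutable_def[OF ctx] by blast
  then obtain T' where T': "?T \<subseteq> T'" "irrefutable ?L A \<rho> T'"
    "\<And>U. irrefutable ?L A \<rho> U \<Longrightarrow> T' \<subseteq> U \<Longrightarrow> U = T'"
    using maximal_irrefutable[OF ctx] by blast
  note max = ctx T'(2,3)
  have "\<not> provable ?L A T' (rbar r)" if "r \<in> A \<union> {1}" for r
  proof
    assume "provable ?L A T' (rbar r)"
    moreover have "provable ?L A T' (Imp (rbar r) \<rho>)"
      unfolding \<rho>_def using that m by (intro Ax RG2a) (auto intro: wf_rbar)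
    ultimately have "provable ?L A T' \<rho>" by (rule MP)
    then show False using maximal_unprovable[OF max] by blast
  qed
  then have "strongly_consistent ?L A T'" by (simp add: strongly_consistent_def)
  then show ?thesis
    using henkin_lang_extends T'(1) maximal_theory[OF max] maximal_deductively_complete[OF max]
      maximal_deductively_Henkin[OF max] by blast
qed

end
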